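(* Let $\mathcal{I}_\varphi$ be a strongly thinnable analytic P-ideal on $\mathbf{N}$ and let $x=(x_n)_{n\in\mathbf{N}}$ be a sequence taking values in a separable metric space. Then $$\lambda\left(\left\{\omega \in (0,1]: \Lambda_x(\mathcal{I}_\varphi)=\Lambda_{x\upharpoonright \omega}(\mathcal{I}_\varphi)\right\}\right)=1.$$
   Context: $\mathbf{N}$ denotes the positive integers. An ideal on $\mathbf{N}$ is a family $\mathcal{I}\subseteq\mathcal{P}(\mathbf{N})$ closed under finite unions and subsets, which contains all finite subsets of $\mathbf{N}$ and is different from $\mathcal{P}(\mathbf{N})$. It is a P-ideal if for every sequence $(A_n)$ of sets in $\mathcal{I}$ there is $A\in\mathcal{I}$ with $A_n\setminus A$ finite for all $n$. It is analytic if, identifying $\mathcal{P}(\mathbf{N})$ with the Cantor space, it is a continuous image of a $G_\delta$-subset of the Cantor space. A lower semicontinuous submeasure is a map $\varphi:\mathcal{P}(\mathbf{N})\to[0,\infty]$ such that (i) $\varphi(\emptyset)=0$; (ii) $\varphi(\{n\})<\infty$ for all $n$; (iii) $\varphi(A)\le\varphi(B)$ whenever $A\subseteq B$; (iv) $\varphi(A\cup B)\le\varphi(A)+\varphi(B)$; (v) $\varphi(A)=\lim_n\varphi(A\cap\{1,\ldots,n\})$ for all $A$. Put $\|A\|_\varphi:=\lim_n\varphi(A\setminus\{1,\ldots,n\})$ and $\mathcal{I}_\varphi:=\{A\subseteq\mathbf{N}:\|A\|_\varphi=0\}$. By a classical theorem of Solecki, an ideal is an analytic P-ideal if and only if it equals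 $\mathcal{I}_\varphi$ for some lower semicontinuous submeasure $\varphi$. For infinite sets $A,B\subseteq\mathbf{N}$ with increasing enumerations $\{a_n\}$ and $\{b_n\}$, write $A\le B$ if $a_n\le b_n$ for all $n$, and $A_B:=\{a_b:b\in B\}$. The asymptotic density of $A$ is $\lim_n|A\cap[1,n]|/n$, when it exists. An ideal $\mathcal{I}$ is weakly thinnable if $A_B\notin\mathcal{I}$ whenever $A\subseteq\mathbf{N}$ admits non-zero asymptotic density and $B\notin\mathcal{I}$. An analytic P-ideal is strongly thinnable if it is of the form $\mathcal{I}_\varphi$ for some lower semicontinuous submeasure $\varphi$ such that: (i) $\mathcal{I}_\varphi$ is weakly thinnable; (ii) given $q>0$ and a set $A\subseteq\mathbf{N}$ with asymptotic density $a>0$, there exists $c=c(q,a)>0$ (depending only on $q$ and $a$) such that $\|B_A\|_\varphi\ge cq$ whenever $\|B\|_\varphi\ge q$; (iii) there exists $c>0$ such that $\|X\|_\varphi\ge c\|Y\|_\varphi$ whenever $X\le Y$. For an ideal $\mathcal{I}$, a point $\ell$ is an $\mathcal{I}$-limit point of a sequence $x$ if there is a subsequence $(x_{n_k})$ with $\lim_k x_{n_k}=\ell$ and $\{n_k:k\in\mathbf{N}\}\notin\mathcal{I}$; the set of these is $\Lambda_x(\mathcal{I})$. For $\omega\in(0,1]$ with non-terminating dyadic expansion $\omega=\sum_{i\ge1}d_i(\omega)2^{-i}$ (so $d_i(\omega)\in\{0,1\}$, with infinitely many equal to $1$), $x\upharpoonright\omega$ denotes the subsequence of $(x_n)$ obtained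 by omitting $x_i$ if and only if $d_i(\omega)=0$, re-indexed by $\mathbf{N}$. $\lambda$ is Lebesgue measure on the completion of the Borel $\sigma$-algebra of $(0,1]$ (so the claim includes measurability of the set). *)

theory Defs
  imports "HOL-Analysis.Analysis"
begin

text \<open>
  The positive integers are rendered as the subset \<open>{1..}\<close> of \<open>nat\<close>; sequences indexed by the
  positive integers are functions on \<open>nat\<close> whose value at \<open>0\<close> plays no role.
\<close>

definition is_ideal :: "nat set set \<Rightarrow> bool" where
  "is_ideal I \<longleftrightarrow>
     I \<subseteq> Pow {1..} \<and>
     (\<forall>A\<in>I. \<forall>B\<in>I. A \<union> B \<in> I) \<and>
     (\<forall>A\<in>I. \<forall>B. B \<subseteq> A \<longrightarrow> B \<in> I) \<and>
     (\<forall>F. F \<subseteq> {1..} \<and> finite F \<longrightarrow> F \<in> I) \<and>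
     I \<noteq> Pow {1..}"

definition is_P_ideal :: "nat set set \<Rightarrow> bool" where
  "is_P_ideal I \<longleftrightarrow>
     is_ideal I \<and>
     (\<forall>A :: nat \<Rightarrow> nat set. range A \<subseteq> I \<longrightarrow> (\<exists>B\<in>I. \<forall>n. finite (A n - B)))"

definition cantor_space :: "(nat \<Rightarrow> bool) topology" where
  "cantor_space = product_topology (\<lambda>_. discrete_topology UNIV) {1..}"

text \<open>Elements of the product are extensional functions, hence the restricted abstraction.\<close>

definition cantor_point :: "nat set \<Rightarrow> nat \<Rightarrow> bool" where
  "cantor_point A = (\<lambda>n\<in>{1..}. n \<in> A)"

definition is_analytic :: "nat set set \<Rightarrow> bool" where
  "is_analytic I \<longleftrightarrow>
     (\<exists>G f. gdelta_in cantor_space G \<and>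
            continuous_map (subtopology cantor_space G) cantor_space f \<and>
            f ` G = cantor_point ` I)"

definition analytic_P_ideal :: "nat set set \<Rightarrow> bool" where
  "analytic_P_ideal I \<longleftrightarrow> is_P_ideal I \<and> is_analytic I"

text \<open>The values of a submeasure outside \<open>Pow {1..}\<close> are irrelevant.\<close>

definition lsc_submeasure :: "(nat set \<Rightarrow> ennreal) \<Rightarrow> bool" where
  "lsc_submeasure \<phi> \<longleftrightarrow>
     \<phi> {} = 0 \<and>
     (\<forall>n\<ge>1. \<phi> {n} < \<infinity>) \<and>
     (\<forall>A B. A \<subseteq> B \<and> B \<subseteq> {1..} \<longrightarrow> \<phi> A \<le> \<phi> B) \<and>
     (\<forall>A B. A \<subseteq> {1..} \<and> B \<subseteq> {1..} \<longrightarrow> \<phi> (A \<union> B) \<le> \<phi> A + \<phi> B) \<and>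
     (\<forall>A. A \<subseteq> {1..} \<longrightarrow> (\<lambda>n. \<phi> (A \<inter> {1..n})) \<longlonglongrightarrow> \<phi> A)"

text \<open>For a submeasure the limit exists, since the sequence is decreasing.\<close>

definition submeasure_norm :: "(nat set \<Rightarrow> ennreal) \<Rightarrow> nat set \<Rightarrow> ennreal" where
  "submeasure_norm \<phi> A = lim (\<lambda>n. \<phi> (A - {1..n}))"

definition submeasure_ideal :: "(nat set \<Rightarrow> ennreal) \<Rightarrow> nat set set" where
  "submeasure_ideal \<phi> = {A. A \<subseteq> {1..} \<and> submeasure_norm \<phi> A = 0}"

text \<open>
  The increasing enumeration \<open>a\<^sub>1 < a\<^sub>2 < \<dots>\<close> of an infinite set; the library's
  \<^const>\<open>enumerate\<close> starts at index \<open>0\<close>.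
\<close>

definition nth_elem :: "nat set \<Rightarrow> nat \<Rightarrow> nat" where
  "nth_elem A n = enumerate A (n - 1)"

definition set_le :: "nat set \<Rightarrow> nat set \<Rightarrow> bool" where
  "set_le A B \<longleftrightarrow> (\<forall>n\<ge>1. nth_elem A n \<le> nth_elem B n)"

text \<open>\<open>sub_index A B\<close> is the set written \<open>A\<^sub>B\<close> in the literature.\<close>

definition sub_index :: "nat set \<Rightarrow> nat set \<Rightarrow> nat set" where
  "sub_index A B = nth_elem A ` B"

definition has_density :: "nat set \<Rightarrow> real \<Rightarrow> bool" where
  "has_density A a \<longleftrightarrow> (\<lambda>n. real (card (A \<inter> {1..n})) / real n) \<longlonglongrightarrow> a"

text \<open>
  In the next two definitions, for the ideals considered, a set of non-zero density, a set outside an ideal and a set of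
  positive norm are automatically infinite, so the enumerations are meaningful.
\<close>

definition weakly_thinnable :: "nat set set \<Rightarrow> bool" where
  "weakly_thinnable I \<longleftrightarrow>
     (\<forall>A B. A \<subseteq> {1..} \<and> B \<subseteq> {1..} \<and> (\<exists>a. a \<noteq> 0 \<and> has_density A a) \<and> B \<notin> I
        \<longrightarrow> sub_index A B \<notin> I)"

definition strongly_thinnable :: "nat set set \<Rightarrow> bool" where
  "strongly_thinnable I \<longleftrightarrow>
     analytic_P_ideal I \<and>
     (\<exists>\<phi>. lsc_submeasure \<phi> \<and> I = submeasure_ideal \<phi> \<and>
        weakly_thinnable (submeasure_ideal \<phi>) \<and>
        (\<forall>q::real. q > 0 \<longrightarrow> (\<forall>a::real. a > 0 \<longrightarrow> (\<exists>c::real. c > 0 \<and>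
           (\<forall>A B. A \<subseteq> {1..} \<and> has_density A a \<and>
                  B \<subseteq> {1..} \<and> submeasure_norm \<phi> B \<ge> ennreal q
              \<longrightarrow> submeasure_norm \<phi> (sub_index B A) \<ge> ennreal (c * q))))) \<and>
        (\<exists>c::real. c > 0 \<and>
           (\<forall>X Y. X \<subseteq> {1..} \<and> Y \<subseteq> {1..} \<and> infinite X \<and> infinite Y \<and> set_le X Y
              \<longrightarrow> submeasure_norm \<phi> X \<ge> ennreal c * submeasure_norm \<phi> Y)))"

definition ideal_limit_points :: "nat set set \<Rightarrow> (nat \<Rightarrow> 'a::topological_space) \<Rightarrow> 'a set" where
  "ideal_limit_points I x =
     {l. \<exists>n :: nat \<Rightarrow> nat. strict_mono n \<and> range n \<subseteq> {1..} \<and>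
           (\<lambda>k. x (n k)) \<longlonglongrightarrow> l \<and> range n \<notin> I}"

definition is_dyadic_expansion :: "(nat \<Rightarrow> nat) \<Rightarrow> real \<Rightarrow> bool" where
  "is_dyadic_expansion d \<omega> \<longleftrightarrow>
     d 0 = 0 \<and> (\<forall>i. d i \<in> {0, 1}) \<and> infinite {i. d i = 1} \<and>
     (\<lambda>i. real (d (Suc i)) / 2 ^ Suc i) sums \<omega>"

definition dyadic_digit :: "real \<Rightarrow> nat \<Rightarrow> nat" where
  "dyadic_digit \<omega> = (THE d. is_dyadic_expansion d \<omega>)"

lemma dyadic_expansion_partial_sum:
  assumes "is_dyadic_expansion d \<omega>"
  shows "\<exists>N::int. (\<Sum>i<n. real (d (Suc i)) / 2 ^ Suc i) = of_int N / 2 ^ n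
           \<and> N = \<lceil>2 ^ n * \<omega>\<rceil> - 1"
proof -
  define f where "f = (\<lambda>i. real (d (Suc i)) / 2 ^ Suc i)"
  have dig: "d i \<in> {0, 1}" for i
    using assms by (auto simp: is_dyadic_expansion_def)
  have inf: "infinite {i. d i = 1}" and f: "f sums \<omega>"
    using assms by (auto simp: is_dyadic_expansion_def f_def)
  have f0: "f i \<ge> 0" for i
    by (simp add: f_def)
  have f1: "f i \<le> (1/2) ^ Suc i" for i
    using dig[of "Suc i"] by (auto simp: f_def power_one_over)
  have tail: "(\<lambda>i. f (i + n)) sums (\<omega> - sum f {..<n})"
    using f by (subst sums_iff_shift) simp
  have geo: "(\<lambda>i. (1/2::real) ^ Suc (i + n)) sums ((1/2) ^ n)"
    using sums_mult[OF power_half_series, of "(1/2)^n"]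
    by (simp add: power_add mult_ac)
  have le: "\<omega> - sum f {..<n} \<le> (1/2) ^ n"
    by (rule sums_le[OF _ tail geo]) (rule f1)
  obtain i where i: "i > n" "d i = 1"
    using inf by (metis (mono_tags, lifting) infinite_nat_iff_unbounded mem_Collect_eq)
  obtain j where j: "i = Suc (j + n)"
    using i by (metis add.commute less_imp_Suc_add)
  have "0 < f (j + n)"
    using i j by (simp add: f_def)
  then have "0 < (\<Sum>i. f (i + n))"
    using suminf_pos_iff[of "\<lambda>i. f (i + n)"] tail f0 by (auto simp: sums_iff)
  then have gt: "0 < \<omega> - sum f {..<n}"
    using tail by (simp add: sums_iff)
  have "\<exists>N::int. sum f {..<n} = of_int N / 2 ^ n"
  proof (induction n)
    case 0
    show ?case by (auto intro: exI[of _ 0])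
  next
    case (Suc n)
    then obtain N :: int where "sum f {..<n} = of_int N / 2 ^ n" by blast
    then have "sum f {..<Suc n} = of_int (2 * N + int (d (Suc n))) / 2 ^ Suc n"
      by (simp add: f_def field_simps)
    then show ?case by blast
  qed
  then obtain N :: int where N: "sum f {..<n} = of_int N / 2 ^ n" by blast
  have "of_int N < 2 ^ n * \<omega>"
    using gt N by (simp add: field_simps)
  moreover have "2 ^ n * \<omega> \<le> of_int N + 1"
    using mult_left_mono[OF le, of "2 ^ n"] N by (simp add: right_diff_distrib power_one_over)
  ultimately have "\<lceil>2 ^ n * \<omega>\<rceil> = N + 1"
    by (simp add: ceiling_eq_iff)
  then show ?thesis
    using N by (auto simp: f_def)
qed

lemma dyadic_expansion_unique:
  assumes "is_dyadic_expansion d \<omega>" "is_dyadic_expansion e \<omega>"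
  shows "d = e"
proof
  fix i
  have eq: "(\<Sum>i<n. real (d (Suc i)) / 2 ^ Suc i) = (\<Sum>i<n. real (e (Suc i)) / 2 ^ Suc i)" for n
    using dyadic_expansion_partial_sum[OF assms(1), of n]
      dyadic_expansion_partial_sum[OF assms(2), of n] by auto
  show "d i = e i"
  proof (cases i)
    case 0
    then show ?thesis using assms by (simp add: is_dyadic_expansion_def)
  next
    case (Suc j)
    have "real (d (Suc j)) / 2 ^ Suc j = real (e (Suc j)) / 2 ^ Suc j"
      using eq[of "Suc j"] eq[of j] by simp
    then show ?thesis using Suc by simp
  qed
qed

lemma dyadic_expansion_exists:
  assumes "\<omega> \<in> {0<..1}"
  shows "\<exists>d. is_dyadic_expansion d \<omega>"
proof -
  define N where "N n = \<lceil>2 ^ n * \<omega>\<rceil> - 1" for n :: nat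
  define d where "d i = (if i = 0 then 0 else nat (N i - 2 * N (i - 1)))" for i
  have N1: "of_int (N n) < 2 ^ n * \<omega>" and N2: "2 ^ n * \<omega> \<le> of_int (N n) + 1" for n
    unfolding N_def by linarith+
  have step: "N (Suc n) - 2 * N n \<in> {0, 1}" for n
  proof -
    have "of_int (N (Suc n)) < (of_int (2 * N n + 2) :: real)"
      using N1[of "Suc n"] N2[of n] by simp
    moreover have "(of_int (2 * N n) :: real) < of_int (N (Suc n) + 1)"
      using N1[of n] N2[of "Suc n"] by simp
    ultimately show ?thesis
      unfolding of_int_less_iff by auto
  qed
  have dig: "d i \<in> {0, 1}" for i
    using step[of "i - 1"] by (cases i) (auto simp: d_def)
  have N0: "N 0 = 0"
    using assms by (simp add: N_def ceiling_eq_iff)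
  have dS: "real (d (Suc i)) = of_int (N (Suc i)) - 2 * of_int (N i)" for i
    using step[of i] by (auto simp: d_def)
  have part: "(\<Sum>i<n. real (d (Suc i)) / 2 ^ Suc i) = of_int (N n) / 2 ^ n" for n
    by (induction n) (auto simp: N0 dS field_simps)
  have "(\<lambda>n. of_int (N n) / 2 ^ n) \<longlonglongrightarrow> \<omega>"
  proof (rule tendsto_sandwich[OF _ _ _ tendsto_const])
    have "\<omega> - (1/2) ^ n \<le> of_int (N n) / 2 ^ n" for n
    proof -
      have "\<omega> \<le> (of_int (N n) + 1) / 2 ^ n"
        using N2[of n] by (simp add: pos_le_divide_eq mult.commute)
      then show ?thesis by (simp add: add_divide_distrib power_one_over)
    qed
    then show "\<forall>\<^sub>F n in sequentially. \<omega> - (1/2) ^ n \<le> of_int (N n) / 2 ^ n"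
      by simp
    show "\<forall>\<^sub>F n in sequentially. of_int (N n) / 2 ^ n \<le> \<omega>"
      using N1 by (auto simp: field_simps less_imp_le)
    show "(\<lambda>n. \<omega> - (1/2) ^ n) \<longlonglongrightarrow> \<omega>"
      using tendsto_diff[OF tendsto_const LIMSEQ_power_zero[of "1/2::real"]] by simp
  qed
  then have sums: "(\<lambda>i. real (d (Suc i)) / 2 ^ Suc i) sums \<omega>"
    unfolding sums_def part .
  have "infinite {i. d i = 1}"
  proof
    assume "finite {i. d i = 1}"
    then obtain n where n: "\<And>i. d i = 1 \<Longrightarrow> i < n"
      unfolding finite_nat_set_iff_bounded by auto
    have "d (Suc i) = 0" if "i \<ge> n" for i
      using n[of "Suc i"] dig[of "Suc i"] that by auto
    then have "(\<lambda>i. real (d (Suc i)) / 2 ^ Suc i) sums (\<Sum>i<n. real (d (Suc i)) / 2 ^ Suc i)"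
      by (intro sums_finite) auto
    then have "\<omega> = of_int (N n) / 2 ^ n"
      using sums sums_unique2 part by metis
    then show False
      using N1[of n] by simp
  qed
  moreover have "d 0 = 0"
    by (simp add: d_def)
  ultimately show ?thesis
    using sums dig unfolding is_dyadic_expansion_def by blast
qed

lemma is_dyadic_expansion_dyadic_digit:
  assumes "\<omega> \<in> {0<..1}"
  shows "is_dyadic_expansion (dyadic_digit \<omega>) \<omega>"
  unfolding dyadic_digit_def
  using dyadic_expansion_exists[OF assms] dyadic_expansion_unique by (metis theI)

definition subseq_along :: "(nat \<Rightarrow> 'a) \<Rightarrow> real \<Rightarrow> nat \<Rightarrow> 'a" where
  "subseq_along x \<omega> n = x (nth_elem {i. i \<ge> 1 \<and> dyadic_digit \<omega> i \<noteq> 0} n)"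

end

theory Submission
  imports Defs "HOL-Library.Discrete_Functions"
begin

text \<open>
  Let \<open>D\<close> be the set of positions of the digits \<open>1\<close> of \<open>\<omega>\<close>. The Rademacher functions are pairwise
  orthogonal, so a second-moment bound along the squares shows that for every infinite \<open>A\<close>, almost
  surely \<open>D\<close> has density \<open>1/2\<close> relative to \<open>A\<close>. With \<open>A\<close> the set of all positive integers, weak
  thinnability shows that limit points of the subsequence are limit points of \<open>x\<close>.

  For the converse, \<open>l\<close> is a limit point if and only if for some \<open>q > 0\<close> the sets
  \<open>{n. dist (x n) l < e}\<close> all have norm at least \<open>q\<close>. Balls with centre in a countable dense set and
  radius \<open>1/m\<close> suffice to test this, so almost surely \<open>D\<close> has relative density \<open>1/2\<close> in all the
  corresponding index sets \<open>A\<close>. Then \<open>A \<inter> D\<close> has norm at least \<open>c q\<close>, with \<open>c\<close> depending on \<open>q\<close> only.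
  As \<open>A \<inter> D\<close> is \<open>D\<^sub>B\<close>, where \<open>B\<close> is the set of indices at which the subsequence visits the ball, and
  \<open>B \<le> D\<^sub>B\<close>, the norm of \<open>B\<close> is at least \<open>c' c q\<close>.
\<close>

section \<open>Averages of orthogonal functions\<close>

text \<open>If n^2 \<le> m < (n+1)^2, the sums up to n^2 and up to m differ by at most 2n terms,
  each bounded by 1. Dividing by m, which is at least n^2, leaves an error of at most 2/n.\<close>

lemma cesaro_mean_tendsto_zero_if_squares:
  fixes f :: "nat \<Rightarrow> real"
  assumes bound: "\<And>i. \<bar>f i\<bar> \<le> 1"
    and squares: "(\<lambda>n. (\<Sum>i<n\<^sup>2. f i) / real (n\<^sup>2)) \<longlonglongrightarrow> 0"
  shows "(\<lambda>n. (\<Sum>i<n. f i) / real n) \<longlonglongrightarrow> 0"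
proof (rule Lim_null_comparison)
  have sqrt_top: "filterlim floor_sqrt at_top sequentially"
    unfolding filterlim_at_top
  proof
    fix Z
    show "eventually (\<lambda>n. Z \<le> floor_sqrt n) sequentially"
      using eventually_ge_at_top[of "Z\<^sup>2"] by eventually_elim (rule le_floor_sqrtI)
  qed
  have "(\<lambda>n. \<bar>(\<Sum>i<n\<^sup>2. f i) / real (n\<^sup>2)\<bar> + 2 / real n) \<longlonglongrightarrow> 0 + 0"
    by (intro tendsto_add tendsto_rabs_zero squares real_tendsto_divide_at_top[OF tendsto_const]
        filterlim_real_sequentially)
  from filterlim_compose[OF this sqrt_top]
  show "(\<lambda>m. \<bar>(\<Sum>i<(floor_sqrt m)\<^sup>2. f i) / real ((floor_sqrt m)\<^sup>2)\<bar> + 2 / real (floor_sqrt m))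
          \<longlonglongrightarrow> 0"
    by simp
  show "eventually (\<lambda>m. norm ((\<Sum>i<m. f i) / real m)
          \<le> \<bar>(\<Sum>i<(floor_sqrt m)\<^sup>2. f i) / real ((floor_sqrt m)\<^sup>2)\<bar> + 2 / real (floor_sqrt m)) sequentially"
    using eventually_gt_at_top[of 0]
  proof eventually_elim
    case (elim m)
    define n where "n = floor_sqrt m"
    have n: "n > 0" "n\<^sup>2 \<le> m" "m < (Suc n)\<^sup>2"
      using elim by (auto simp: n_def Suc_floor_sqrt_power2_gt)
    then have diff: "m - n\<^sup>2 \<le> 2 * n"
      by (simp add: power2_eq_square)
    have "(\<Sum>i<m. f i) = (\<Sum>i<n\<^sup>2. f i) + (\<Sum>i\<in>{n\<^sup>2..<m}. f i)"
      using n(2) by (simp add: sum.atLeastLessThan_concat atLeast0LessThan[symmetric])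
    moreover have "\<bar>\<Sum>i\<in>{n\<^sup>2..<m}. f i\<bar> \<le> 2 * real n"
    proof -
      have "\<bar>\<Sum>i\<in>{n\<^sup>2..<m}. f i\<bar> \<le> (\<Sum>i\<in>{n\<^sup>2..<m}. 1)"
        by (rule order_trans[OF sum_abs sum_mono]) (rule bound)
      also have "\<dots> \<le> 2 * real n"
        using diff by simp
      finally show ?thesis .
    qed
    ultimately have "\<bar>\<Sum>i<m. f i\<bar> \<le> \<bar>\<Sum>i<n\<^sup>2. f i\<bar> + 2 * real n"
      by linarith
    then have "\<bar>\<Sum>i<m. f i\<bar> / real m \<le> (\<bar>\<Sum>i<n\<^sup>2. f i\<bar> + 2 * real n) / real (n\<^sup>2)"
      using n(1,2) by (intro frac_le) (auto simp del: of_nat_power)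
    also have "\<dots> = \<bar>(\<Sum>i<n\<^sup>2. f i) / real (n\<^sup>2)\<bar> + 2 / real n"
      using n(1) by (simp add: add_divide_distrib power2_eq_square)
    finally show ?case
      by (simp add: n_def)
  qed
qed

text \<open>When the square is expanded, the off-diagonal products integrate to 0 and each of the
  \<open>n\<close> diagonal ones contributes at most the total mass.\<close>

lemma (in finite_measure) integral_square_sum_orthogonal_le:
  fixes f :: "nat \<Rightarrow> 'a \<Rightarrow> real"
  assumes meas [measurable]: "\<And>i. f i \<in> borel_measurable M"
    and bound: "\<And>i \<omega>. \<bar>f i \<omega>\<bar> \<le> 1"
    and orth: "\<And>i j. i < j \<Longrightarrow> (\<integral>\<omega>. f i \<omega> * f j \<omega> \<partial>M) = 0"
  shows "(\<integral>\<omega>. (\<Sum>i<n. f i \<omega>)\<^sup>2 \<partial>M) \<le> real n * measure M (space M)"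
proof -
  have int: "integrable M (\<lambda>\<omega>. f i \<omega> * f j \<omega>)" for i j
  proof (rule integrable_const_bound[where B = 1])
    show "AE \<omega> in M. norm (f i \<omega> * f j \<omega>) \<le> 1"
      using mult_mono[OF bound bound] by (auto simp: abs_mult)
  qed simp
  have orth': "(\<integral>\<omega>. f i \<omega> * f j \<omega> \<partial>M) = 0" if "i \<noteq> j" for i j
    using orth[of i j] orth[of j i] that by (cases "i < j") (auto simp: mult.commute)
  have diag: "(\<integral>\<omega>. f i \<omega> * f i \<omega> \<partial>M) \<le> measure M (space M)" for i
  proof -
    have "(\<integral>\<omega>. f i \<omega> * f i \<omega> \<partial>M) \<le> (\<integral>\<omega>. 1 \<partial>M)"
      using bound[of i] by (intro integral_mono int) (auto simp: abs_square_le_1 simp flip: power2_eq_square)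
    then show ?thesis by simp
  qed
  have "(\<integral>\<omega>. (\<Sum>i<n. f i \<omega>)\<^sup>2 \<partial>M) = (\<integral>\<omega>. (\<Sum>i<n. \<Sum>j<n. f i \<omega> * f j \<omega>) \<partial>M)"
    by (simp add: power2_eq_square sum_product)
  also have "\<dots> = (\<Sum>i<n. \<Sum>j<n. (\<integral>\<omega>. f i \<omega> * f j \<omega> \<partial>M))"
    by (simp add: int)
  also have "\<dots> = (\<Sum>i<n. \<Sum>j<n. if j = i then (\<integral>\<omega>. f i \<omega> * f i \<omega> \<partial>M) else 0)"
    by (intro sum.cong refl) (auto simp: orth')
  also have "\<dots> = (\<Sum>i<n. (\<integral>\<omega>. f i \<omega> * f i \<omega> \<partial>M))"
    by simp
  also have "\<dots> \<le> (\<Sum>i<n. measure M (space M))"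
    by (intro sum_mono diag)
  finally show ?thesis by simp
qed

text \<open>The mean of the first n^2 functions has second moment at most the total mass over n^2,
  which is summable in n. Hence the sum of the squared means has finite integral, is finite almost
  everywhere, and its terms tend to 0. The gaps between squares are then filled.\<close>

lemma (in finite_measure) AE_cesaro_mean_orthogonal:
  fixes f :: "nat \<Rightarrow> 'a \<Rightarrow> real"
  assumes meas [measurable]: "\<And>i. f i \<in> borel_measurable M"
    and bound: "\<And>i \<omega>. \<bar>f i \<omega>\<bar> \<le> 1"
    and orth: "\<And>i j. i < j \<Longrightarrow> (\<integral>\<omega>. f i \<omega> * f j \<omega> \<partial>M) = 0"
  shows "AE \<omega> in M. (\<lambda>n. (\<Sum>i<n. f i \<omega>) / real n) \<longlonglongrightarrow> 0"
proof -
  define g where "g n \<omega> = ((\<Sum>i<n\<^sup>2. f i \<omega>) / real (n\<^sup>2))\<^sup>2" for n \<omega>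
  have g_meas [measurable]: "g n \<in> borel_measurable M" for n
    unfolding g_def by measurable
  have g_le: "g n \<omega> \<le> 1" for n \<omega>
  proof -
    have "\<bar>\<Sum>i<n\<^sup>2. f i \<omega>\<bar> \<le> (\<Sum>i<n\<^sup>2. 1)"
      by (rule order_trans[OF sum_abs sum_mono]) (rule bound)
    then have "\<bar>(\<Sum>i<n\<^sup>2. f i \<omega>) / real (n\<^sup>2)\<bar> \<le> 1"
      by (simp add: divide_le_eq)
    then show ?thesis
      unfolding g_def by (simp only: abs_square_le_1)
  qed
  have g_int: "integrable M (g n)" for n
  proof (rule integrable_const_bound[where B = 1])
    show "AE \<omega> in M. norm (g n \<omega>) \<le> 1"
      using g_le by (simp add: g_def)
  qed measurable
  have "(\<integral>\<^sup>+\<omega>. ennreal (g n \<omega>) \<partial>M) \<le> ennreal (measure M (space M) * (inverse (real n))\<^sup>2)" for n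
  proof (cases "n = 0")
    \<comment> \<open>Both sides are 0 here, since division by 0 and \<open>inverse 0\<close> are
      0.\<close>
    case True
    then show ?thesis by (simp add: g_def)
  next
    case False
    have "(\<integral>\<omega>. g n \<omega> \<partial>M) = (\<integral>\<omega>. (\<Sum>i<n\<^sup>2. f i \<omega>)\<^sup>2 \<partial>M) / (real (n\<^sup>2))\<^sup>2"
      unfolding g_def power_divide by (rule integral_divide_zero)
    also have "\<dots> \<le> (real (n\<^sup>2) * measure M (space M)) / (real (n\<^sup>2))\<^sup>2"
      by (intro divide_right_mono integral_square_sum_orthogonal_le assms) auto
    also have "\<dots> = measure M (space M) * (inverse (real n))\<^sup>2"
      using False by (simp add: power2_eq_square field_simps)
    finally have "(\<integral>\<omega>. g n \<omega> \<partial>M) \<le> measure M (space M) * (inverse (real n))\<^sup>2" .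
    then show ?thesis
      by (subst nn_integral_eq_integral[OF g_int]) (auto simp: g_def[abs_def] intro!: ennreal_leI)
  qed
  then have "(\<Sum>n. \<integral>\<^sup>+\<omega>. ennreal (g n \<omega>) \<partial>M)
      \<le> (\<Sum>n. ennreal (measure M (space M) * (inverse (real n))\<^sup>2))"
    by (intro suminf_le) auto
  also have "\<dots> < \<infinity>"
  proof -
    have "summable (\<lambda>n. inverse ((real n)\<^sup>2))"
      using inverse_power_summable[of 2, where 'a = real] by simp
    then have "summable (\<lambda>n. measure M (space M) * (inverse (real n))\<^sup>2)"
      by (intro summable_mult) (simp add: power_inverse)
    then show ?thesis
      using ennreal_suminf_neq_top by (simp add: less_top)
  qed
  finally have "(\<integral>\<^sup>+\<omega>. (\<Sum>n. ennreal (g n \<omega>)) \<partial>M) \<noteq> \<infinity>"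
    by (subst nn_integral_suminf) auto
  then have "AE \<omega> in M. (\<Sum>n. ennreal (g n \<omega>)) \<noteq> \<infinity>"
    by (intro nn_integral_PInf_AE) auto
  then show ?thesis
  proof eventually_elim
    case (elim \<omega>)
    then have "summable (\<lambda>n. g n \<omega>)"
      by (intro summable_suminf_not_top) (auto simp: g_def)
    then have "(\<lambda>n. g n \<omega>) \<longlonglongrightarrow> 0"
      by (rule summable_LIMSEQ_zero)
    then have "(\<lambda>n. (\<Sum>i<n\<^sup>2. f i \<omega>) / real (n\<^sup>2)) \<longlonglongrightarrow> 0"
      unfolding g_def by (simp only: power_tendsto_0_iff zero_less_numeral)
    with bound show ?case
      by (rule cesaro_mean_tendsto_zero_if_squares)
  qed
qed

section \<open>Rademacher functions and dyadic digits\<close>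

lemma set_integral_shift_real:
  fixes g :: "real \<Rightarrow> real"
  shows "(LINT x:{a + t<..b + t}|lborel. g x) = (LINT x:{a<..b}|lborel. g (x + t))"
  unfolding set_lebesgue_integral_def
  by (subst lborel_integral_real_affine[where c = 1 and t = t])
     (auto intro!: Bochner_Integration.integral_cong simp: add.commute split: split_indicator)

text \<open>By periodicity the piece over (0,h] can be moved to (1,1+h], so the integral over (0,1]
  equals the one over (h,1+h]. Antiperiodicity makes the latter its negative.\<close>

lemma set_integral_antiperiodic_zero:
  fixes g :: "real \<Rightarrow> real"
  assumes meas [measurable]: "g \<in> borel_measurable borel"
    and bound: "\<And>x. \<bar>g x\<bar> \<le> 1"
    and anti: "\<And>x. g (x + h) = - g x"
    and period: "\<And>x. g (x + 1) = g x"
    and h: "0 < h" "h \<le> 1"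
  shows "(LINT x:{0<..1}|lborel. g x) = 0"
proof -
  have int: "set_integrable lborel {a<..b} g" for a b
    unfolding set_integrable_def
  proof (rule Bochner_Integration.integrable_bound)
    show "integrable lborel (indicator {a<..b} :: real \<Rightarrow> real)"
      by (cases "a \<le> b") (auto intro!: integrable_real_indicator)
    show "AE x in lborel. norm (indicat_real {a<..b} x *\<^sub>R g x) \<le> norm (indicat_real {a<..b} x)"
      using bound by (auto split: split_indicator)
  qed measurable
  have split: "(LINT x:{a<..c}|lborel. g x) = (LINT x:{a<..b}|lborel. g x) + (LINT x:{b<..c}|lborel. g x)"
    if "a \<le> b" "b \<le> c" for a b c
  proof -
    have "{a<..c} = {a<..b} \<union> {b<..c}"
      using that by auto
    then show ?thesis
      using set_integral_Un[OF _ int int, of a b b c] by auto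
  qed
  have "(LINT x:{0<..1}|lborel. g x) = (LINT x:{0<..h}|lborel. g x) + (LINT x:{h<..1}|lborel. g x)"
    using h by (intro split) auto
  also have "(LINT x:{0<..h}|lborel. g x) = (LINT x:{1<..1 + h}|lborel. g x)"
    using set_integral_shift_real[of 0 1 h g] by (simp add: period add.commute)
  also have "\<dots> + (LINT x:{h<..1}|lborel. g x) = (LINT x:{h<..1 + h}|lborel. g x)"
    using split[of h 1 "1 + h"] h by simp
  also have "\<dots> = - (LINT x:{0<..1}|lborel. g x)"
    using set_integral_shift_real[of 0 h 1 g] int by (simp add: anti set_integral_uminus)
  finally show ?thesis by simp
qed

text \<open>
  The non-terminating expansion makes \<open>\<lceil>2\<^sup>i \<omega>\<rceil> - 1\<close> the integer whose last binary digit is the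
  \<open>i\<close>-th digit of \<open>\<omega>\<close>.
\<close>

definition rademacher :: "nat \<Rightarrow> real \<Rightarrow> real" where
  "rademacher i \<omega> = (if even \<lceil>2 ^ i * \<omega>\<rceil> then 1 else - 1)"

lemma rademacher_measurable [measurable]: "rademacher i \<in> borel_measurable borel"
  unfolding rademacher_def by measurable

lemma abs_rademacher_le: "\<bar>rademacher i \<omega>\<bar> \<le> 1"
  by (simp add: rademacher_def)

text \<open>The shift adds the integer \<open>k\<close> to 2^i \<omega>, hence to its ceiling, whose
  parity changes exactly for odd \<open>k\<close>.\<close>

lemma rademacher_shift:
  assumes "2 ^ i * t = of_int k"
  shows "rademacher i (\<omega> + t) = (if even k then 1 else - 1) * rademacher i \<omega>"
  using assms by (auto simp: rademacher_def distrib_left)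

text \<open>A shift by 1/2^i flips the sign of the i-th function and preserves the j-th, because
  2^(j-i) is even. As \<open>1 \<le> i < j\<close>, both 2^i and 2^j are even, so 1 is a period of
  the product.\<close>

lemma rademacher_orthogonal:
  assumes "1 \<le> i" "i < j"
  shows "(LINT \<omega>:{0<..1}|lborel. rademacher i \<omega> * rademacher j \<omega>) = 0"
proof (rule set_integral_antiperiodic_zero[where h = "1 / 2 ^ i"])
  have "rademacher i (x + 1 / 2 ^ i) = - rademacher i x" for x
    using rademacher_shift[of i "1 / 2 ^ i" 1 x] by simp
  moreover have "rademacher j (x + 1 / 2 ^ i) = rademacher j x" for x
  proof -
    have "(2::real) ^ j * (1 / 2 ^ i) = of_int (2 ^ (j - i))"
      using assms by (simp add: field_simps flip: power_add)
    from rademacher_shift[OF this] show ?thesis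
      using assms by simp
  qed
  ultimately show "rademacher i (x + 1 / 2 ^ i) * rademacher j (x + 1 / 2 ^ i)
      = - (rademacher i x * rademacher j x)" for x
    by simp
  show "rademacher i (x + 1) * rademacher j (x + 1) = rademacher i x * rademacher j x" for x
    using rademacher_shift[of i 1 "2 ^ i" x] rademacher_shift[of j 1 "2 ^ j" x] assms
    by simp
  show "\<bar>rademacher i x * rademacher j x\<bar> \<le> 1" for x
    by (simp add: rademacher_def)
qed auto

text \<open>If \<open>K\<close> and \<open>N\<close> are the numerators of the partial sums of
  length i-1 and i, then N = 2K + d_i. So the digit has the parity of \<open>N\<close>, which is the
  ceiling minus 1.\<close>

lemma rademacher_eq_dyadic_digit:
  assumes "\<omega> \<in> {0<..1}" "i \<ge> 1"
  shows "rademacher i \<omega> = 2 * real (dyadic_digit \<omega> i) - 1"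
proof -
  obtain j where j: "i = Suc j"
    using assms(2) by (cases i) auto
  define d where "d = dyadic_digit \<omega>"
  have d: "is_dyadic_expansion d \<omega>"
    unfolding d_def using assms(1) by (rule is_dyadic_expansion_dyadic_digit)
  obtain N where N: "(\<Sum>i<Suc j. real (d (Suc i)) / 2 ^ Suc i) = of_int N / 2 ^ Suc j"
      "N = \<lceil>2 ^ Suc j * \<omega>\<rceil> - 1"
    using dyadic_expansion_partial_sum[OF d, of "Suc j"] by blast
  obtain K where K: "(\<Sum>i<j. real (d (Suc i)) / 2 ^ Suc i) = of_int K / 2 ^ j"
    using dyadic_expansion_partial_sum[OF d, of j] by blast
  have "real (d i) = of_int (N - 2 * K)"
    using N(1) K by (simp add: j field_simps)
  then have "int (d i) = N - 2 * K"
    by (metis of_int_eq_iff of_int_of_nat_eq)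
  moreover have "d i \<in> {0, 1}"
    using d by (auto simp: is_dyadic_expansion_def)
  ultimately have "even \<lceil>2 ^ i * \<omega>\<rceil> \<longleftrightarrow> d i = 1" "d i = 0 \<or> d i = 1"
    using N(2) unfolding j by auto presburger+
  then show ?thesis
    unfolding rademacher_def d_def by auto
qed

text \<open>Orthogonality passes to any subsequence of the Rademacher functions, and a digit is
  (r+1)/2 for the corresponding Rademacher value r.\<close>

lemma AE_dyadic_digit_mean_half:
  fixes a :: "nat \<Rightarrow> nat"
  assumes a: "strict_mono a" "\<And>k. a k \<ge> 1"
  shows "AE \<omega> in lborel. \<omega> \<in> {0<..1} \<longrightarrow>
           (\<lambda>n. (\<Sum>k<n. real (dyadic_digit \<omega> (a k))) / real n) \<longlonglongrightarrow> 1 / 2"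
proof -
  define M where "M = restrict_space lborel {0<..1::real}"
  interpret finite_measure M
    by (rule finite_measureI) (simp add: M_def emeasure_restrict_space space_restrict_space)
  have "AE \<omega> in M. (\<lambda>n. (\<Sum>k<n. rademacher (a k) \<omega>) / real n) \<longlonglongrightarrow> 0"
  proof (rule AE_cesaro_mean_orthogonal)
    show "rademacher (a k) \<in> borel_measurable M" for k
      unfolding M_def by (rule measurable_restrict_space1) simp
    show "(\<integral>\<omega>. rademacher (a k) \<omega> * rademacher (a l) \<omega> \<partial>M) = 0" if "k < l" for k l
      using rademacher_orthogonal[of "a k" "a l"] a that
      by (simp add: M_def integral_restrict_space set_lebesgue_integral_def strict_monoD)
  qed (rule abs_rademacher_le)
  then have "AE \<omega> in lborel. \<omega> \<in> {0<..1} \<longrightarrow> (\<lambda>n. (\<Sum>k<n. rademacher (a k) \<omega>) / real n) \<longlonglongrightarrow> 0"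
    unfolding M_def by (subst (asm) AE_restrict_space_iff) auto
  then show ?thesis
  proof eventually_elim
    case (elim \<omega>)
    show ?case
    proof
      assume \<omega>: "\<omega> \<in> {0<..1}"
      have "(\<lambda>n. ((\<Sum>k<n. rademacher (a k) \<omega>) / real n + 1) / 2) \<longlonglongrightarrow> (0 + 1) / 2"
        using elim \<omega> by (intro tendsto_intros) auto
      \<comment> \<open>The two expressions agree for n > 0 only: at n = 0 they are 1/2 and
        0.\<close>
      moreover have "eventually (\<lambda>n. ((\<Sum>k<n. rademacher (a k) \<omega>) / real n + 1) / 2
          = (\<Sum>k<n. real (dyadic_digit \<omega> (a k))) / real n) sequentially"
        using eventually_gt_at_top[of 0]
        by eventually_elim
           (simp add: rademacher_eq_dyadic_digit[OF \<omega> a(2)] sum_subtractf field_simps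
              flip: sum_distrib_left)
      ultimately show "(\<lambda>n. (\<Sum>k<n. real (dyadic_digit \<omega> (a k))) / real n) \<longlonglongrightarrow> 1 / 2"
        by (rule Lim_transform_eventually[THEN tendsto_eq_rhs]) simp
    qed
  qed
qed

section \<open>Submeasures and limit points\<close>

text \<open>A strictly increasing map sends the least element of \<open>B\<close> to the least
  element of the image. Removing both leaves the same situation, so the induction varies
  \<open>B\<close>.\<close>

lemma enumerate_strict_mono_image:
  fixes f :: "nat \<Rightarrow> nat"
  assumes f: "strict_mono f" and "infinite B"
  shows "enumerate (f ` B) n = f (enumerate B n)"
  using assms(2)
proof (induction n arbitrary: B)
  have zero: "enumerate (f ` B) 0 = f (enumerate B 0)" if "infinite B" for B
  proof -
    have "B \<noteq> {}" using that by auto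
    then have "\<exists>x\<in>B. \<forall>y\<in>B. x \<le> y"
      by (intro bexI[of _ "LEAST x. x \<in> B"]) (auto intro: LeastI Least_le)
    from Least_mono[OF strict_mono_mono[OF f] this] show ?thesis
      by (simp add: enumerate_0)
  qed
  {
    case 0
    then show ?case by (rule zero)
  next
    case (Suc n)
    have "f ` B - {enumerate (f ` B) 0} = f ` (B - {enumerate B 0})"
      unfolding zero[OF Suc.prems] using strict_mono_imp_inj_on[OF f] by (auto dest: injD)
    then show ?case
      using Suc.IH[of "B - {enumerate B 0}"] Suc.prems by (simp add: enumerate_Suc')
  }
qed

lemma nth_elem_in: "infinite A \<Longrightarrow> nth_elem A n \<in> A"
  by (simp add: nth_elem_def enumerate_in_set)

text \<open>Truncated subtraction gives \<open>nth_elem A 0 = nth_elem A 1\<close>, hence the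
  condition \<open>1 \<le> m\<close>.\<close>

lemma nth_elem_less: "infinite A \<Longrightarrow> 1 \<le> m \<Longrightarrow> m < n \<Longrightarrow> nth_elem A m < nth_elem A n"
  by (auto simp: nth_elem_def intro!: enumerate_mono)

lemma nth_elem_surj:
  assumes "infinite A" "a \<in> A"
  shows "\<exists>k\<ge>1. nth_elem A k = a"
proof -
  obtain n where "enumerate A n = a"
    using enumerate_Ex[OF assms] by blast
  then show ?thesis
    by (intro exI[of _ "Suc n"]) (simp add: nth_elem_def)
qed

text \<open>Used with both orders of the two sets: A \<inter> D is a thinning of \<open>A\<close>
  along the indices where it meets \<open>D\<close>, and a thinning of \<open>D\<close> along the
  indices where it meets \<open>A\<close>.\<close>

lemma sub_index_preimage:
  assumes "infinite A"
  shows "sub_index A {k. 1 \<le> k \<and> nth_elem A k \<in> D} = A \<inter> D"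
  using nth_elem_in[OF assms] nth_elem_surj[OF assms] by (fastforce simp: sub_index_def image_iff)

text \<open>With d and b the enumerations of \<open>D\<close> and \<open>B\<close>, the n-th element
  of the thinned set is d at b_n, and d at k is at least k.\<close>

lemma set_le_sub_index:
  assumes D: "infinite D" "D \<subseteq> {1..}" and B: "infinite B" "B \<subseteq> {1..}"
  shows "set_le B (sub_index D B)"
  unfolding set_le_def
proof (intro allI impI)
  fix n :: nat
  assume "n \<ge> 1"
  \<comment> \<open>Setting the value at 0 to 0 makes the enumeration of \<open>D\<close> strictly
    increasing on all of \<open>nat\<close>, as 0 is not in \<open>D\<close>. The image of
    \<open>B\<close> is unchanged, as 0 is not in \<open>B\<close>.\<close>
  define f where "f k = (if k = 0 then 0 else nth_elem D k)" for k
  have "f k < f (Suc k)" for k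
    using nth_elem_in[OF D(1), of "Suc 0"] nth_elem_less[OF D(1), of k "Suc k"] D(2)
    by (auto simp: f_def)
  then have f: "strict_mono f"
    by (simp add: strict_mono_Suc_iff)
  have "sub_index D B = f ` B"
    using B(2) by (auto simp: sub_index_def f_def intro!: image_cong)
  then have "nth_elem (sub_index D B) n = f (nth_elem B n)"
    by (simp add: nth_elem_def enumerate_strict_mono_image[OF f B(1)])
  then show "nth_elem B n \<le> nth_elem (sub_index D B) n"
    using strict_mono_imp_increasing[OF f] by simp
qed

context
  fixes \<phi> :: "nat set \<Rightarrow> ennreal"
  assumes lsc: "lsc_submeasure \<phi>"
begin

lemma submeasure_mono: "A \<subseteq> B \<Longrightarrow> B \<subseteq> {1..} \<Longrightarrow> \<phi> A \<le> \<phi> B"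
  using lsc by (simp add: lsc_submeasure_def)

lemma submeasure_lsc: "A \<subseteq> {1..} \<Longrightarrow> (\<lambda>n. \<phi> (A \<inter> {1..n})) \<longlonglongrightarrow> \<phi> A"
  using lsc by (simp add: lsc_submeasure_def)

lemma submeasure_norm_eq_INF:
  assumes "A \<subseteq> {1..}"
  shows "submeasure_norm \<phi> A = (INF n. \<phi> (A - {1..n}))"
proof -
  have "decseq (\<lambda>n. \<phi> (A - {1..n}))"
    by (intro decseq_SucI submeasure_mono) (use assms in auto)
  then show ?thesis
    unfolding submeasure_norm_def by (intro limI LIMSEQ_INF)
qed

lemma submeasure_norm_le:
  assumes "A \<subseteq> {1..}"
  shows "submeasure_norm \<phi> A \<le> \<phi> (A - {1..n})"
  unfolding submeasure_norm_eq_INF[OF assms] by (rule INF_lower) simp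

text \<open>The norm ignores initial segments: \<open>A\<close> cut at the larger of
  \<open>m\<close> and \<open>n\<close> lies in \<open>B\<close> cut at \<open>n\<close>.\<close>

lemma submeasure_norm_mono_almost:
  assumes "A - {1..m} \<subseteq> B" "A \<subseteq> {1..}" "B \<subseteq> {1..}"
  shows "submeasure_norm \<phi> A \<le> submeasure_norm \<phi> B"
  unfolding submeasure_norm_eq_INF[OF assms(3)]
proof (rule INF_greatest)
  fix n
  have "submeasure_norm \<phi> A \<le> \<phi> (A - {1..max m n})"
    using assms(2) by (rule submeasure_norm_le)
  also have "\<dots> \<le> \<phi> (B - {1..n})"
    using assms by (intro submeasure_mono) auto
  finally show "submeasure_norm \<phi> A \<le> \<phi> (B - {1..n})" .
qed

lemma submeasure_norm_finite:
  assumes "finite A" "A \<subseteq> {1..}"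
  shows "submeasure_norm \<phi> A = 0"
proof -
  obtain m where "A \<subseteq> {..m}"
    using assms(1) finite_nat_iff_bounded_le by blast
  then have "submeasure_norm \<phi> A \<le> submeasure_norm \<phi> {}"
    using assms(2) by (intro submeasure_norm_mono_almost[of _ m]) auto
  also have "\<dots> \<le> 0"
    using submeasure_norm_le[of "{}" 0] lsc by (simp add: lsc_submeasure_def)
  finally show ?thesis by simp
qed

lemma infinite_if_submeasure_norm_pos:
  "A \<subseteq> {1..} \<Longrightarrow> 0 < submeasure_norm \<phi> A \<Longrightarrow> infinite A"
  by (metis submeasure_norm_finite less_irrefl)

text \<open>Every tail of \<open>A\<close> has submeasure above \<open>r\<close>, and by lower
  semicontinuity so has a finite part of that tail. These blocks are the material for gluing sets
  together below.\<close>

lemma submeasure_norm_block: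
  assumes "A \<subseteq> {1..}" "r < submeasure_norm \<phi> A"
  shows "\<exists>n>m. r < \<phi> (A \<inter> {m<..n})"
proof -
  have "(\<lambda>n. \<phi> ((A - {1..m}) \<inter> {1..n})) \<longlonglongrightarrow> \<phi> (A - {1..m})"
    using assms(1) by (intro submeasure_lsc) auto
  moreover have "r < \<phi> (A - {1..m})"
    using assms(2) submeasure_norm_le[OF assms(1)] by (rule less_le_trans)
  ultimately have "eventually (\<lambda>n. r < \<phi> ((A - {1..m}) \<inter> {1..n})) sequentially"
    by (rule order_tendstoD(1))
  then obtain K where K: "\<And>n. n \<ge> K \<Longrightarrow> r < \<phi> ((A - {1..m}) \<inter> {1..n})"
    unfolding eventually_sequentially by blast
  define n where "n = max K (Suc m)"
  have "(A - {1..m}) \<inter> {1..n} = A \<inter> {m<..n}"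
    using assms(1) by auto
  then have "r < \<phi> (A \<inter> {m<..n})"
    using K[of n] by (simp add: n_def)
  moreover have "n > m"
    by (simp add: n_def)
  ultimately show ?thesis by blast
qed

text \<open>The point is that one \<open>q\<close> serves all \<open>e\<close>. The index set of a
  subsequence converging to \<open>l\<close> lies, up to an initial segment, in every
  neighbourhood's index set, so it bounds all the norms from below. Conversely, finite blocks from
  shrinking neighbourhoods are glued together diagonally.\<close>

lemma ideal_limit_points_iff:
  fixes x :: "nat \<Rightarrow> 'a::metric_space"
  shows "l \<in> ideal_limit_points (submeasure_ideal \<phi>) x \<longleftrightarrow>
    (\<exists>q::real. q > 0 \<and> (\<forall>e>0. ennreal q \<le> submeasure_norm \<phi> {n. 1 \<le> n \<and> dist (x n) l < e}))"
    (is "_ \<longleftrightarrow> ?R")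
proof
  assume "l \<in> ideal_limit_points (submeasure_ideal \<phi>) x"
  then obtain n where n: "strict_mono n" "range n \<subseteq> {1..}" "(\<lambda>k. x (n k)) \<longlonglongrightarrow> l"
      "submeasure_norm \<phi> (range n) \<noteq> 0"
    by (auto simp: ideal_limit_points_def submeasure_ideal_def)
  \<comment> \<open>The norm may be infinite, so a positive real strictly below it is taken.\<close>
  then obtain q where q: "q > 0" "ennreal q < submeasure_norm \<phi> (range n)"
  proof -
    obtain r where r: "0 < r" "r < submeasure_norm \<phi> (range n)"
      using n(4) dense zero_less_iff_neq_zero by blast
    then have "r \<noteq> top"
      by auto
    then obtain q where "r = ennreal q"
      by (cases r) auto
    then show ?thesis
      using r that by simp
  qed
  have "ennreal q \<le> submeasure_norm \<phi> {n. 1 \<le> n \<and> dist (x n) l < e}" if "e > 0" for e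
  proof -
    obtain K where K: "\<And>k. k \<ge> K \<Longrightarrow> dist (x (n k)) l < e"
      using metric_LIMSEQ_D[OF n(3) \<open>e > 0\<close>] by blast
    have "submeasure_norm \<phi> (range n) \<le> submeasure_norm \<phi> {n. 1 \<le> n \<and> dist (x n) l < e}"
    proof (rule submeasure_norm_mono_almost[OF _ n(2)])
      show "range n - {1..n K} \<subseteq> {n. 1 \<le> n \<and> dist (x n) l < e}"
      proof
        fix i assume i: "i \<in> range n - {1..n K}"
        then obtain k where k: "i = n k" by auto
        then have "n K < n k" "1 \<le> i"
          using i n(2) by auto
        then have "K \<le> k"
          using n(1) by (simp add: strict_mono_less)
        then show "i \<in> {n. 1 \<le> n \<and> dist (x n) l < e}"
          using K k \<open>1 \<le> i\<close> by auto
      qed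
    qed auto
    with q(2) show ?thesis by simp
  qed
  with q(1) show ?R by blast
next
  assume ?R
  then obtain q :: real where q: "q > 0"
    "\<And>e. e > 0 \<Longrightarrow> ennreal q \<le> submeasure_norm \<phi> {n. 1 \<le> n \<and> dist (x n) l < e}"
    by blast
  define A where "A m = {n. 1 \<le> n \<and> dist (x n) l < 1 / real (Suc m)}" for m
  \<comment> \<open>Halving \<open>q\<close> provides the strict inequality from which blocks are
    extracted.\<close>
  have A: "A m \<subseteq> {1..}" "ennreal (q / 2) < submeasure_norm \<phi> (A m)" for m
  proof -
    have "ennreal (q / 2) < ennreal q"
      using q(1) by (intro ennreal_lessI) auto
    also have "\<dots> \<le> submeasure_norm \<phi> (A m)"
      unfolding A_def by (rule q(2)) simp
    finally show "ennreal (q / 2) < submeasure_norm \<phi> (A m)" .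
  qed (auto simp: A_def)
  \<comment> \<open>Block endpoints are chosen recursively; \<open>True\<close> stands for the
    absence of a condition on a single endpoint.\<close>
  have "\<exists>N. \<forall>m. True \<and> N m < N (Suc m) \<and> ennreal (q / 2) < \<phi> (A m \<inter> {N m<..N (Suc m)})"
    by (rule dependent_nat_choice) (use submeasure_norm_block[OF A] in auto)
  then obtain N where N: "\<And>m. N m < N (Suc m) \<and> ennreal (q / 2) < \<phi> (A m \<inter> {N m<..N (Suc m)})"
    by blast
  have N_mono: "strict_mono N"
    using N by (simp add: strict_mono_Suc_iff)
  \<comment> \<open>Finite blocks of large submeasure, taken from smaller and smaller neighbourhoods of \<open>l\<close>.\<close>
  define B where "B = (\<Union>m. A m \<inter> {N m<..N (Suc m)})"
  have B: "B \<subseteq> {1..}"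
    using A(1) by (auto simp: B_def)
  have "ennreal (q / 2) \<le> submeasure_norm \<phi> B"
    unfolding submeasure_norm_eq_INF[OF B]
  proof (rule INF_greatest)
    fix n
    \<comment> \<open>Since \<open>N n\<close> is at least \<open>n\<close>, the n-th block survives
      the removal of \<open>{1..n}\<close> intact.\<close>
    have "ennreal (q / 2) \<le> \<phi> (A n \<inter> {N n<..N (Suc n)})"
      using N by (simp add: less_imp_le)
    also have "\<dots> \<le> \<phi> (B - {1..n})"
    proof (rule submeasure_mono)
      show "A n \<inter> {N n<..N (Suc n)} \<subseteq> B - {1..n}"
        using strict_mono_imp_increasing[OF N_mono, of n] by (auto simp: B_def)
    qed (use B in auto)
    finally show "ennreal (q / 2) \<le> \<phi> (B - {1..n})" .
  qed
  then have B_pos: "0 < submeasure_norm \<phi> B"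
    using q(1) by (auto intro: less_le_trans[rotated])
  then have B_inf: "infinite B"
    by (rule infinite_if_submeasure_norm_pos[OF B])
  have "(\<lambda>k. x (enumerate B k)) \<longlonglongrightarrow> l"
  proof (rule metric_LIMSEQ_I)
    fix e :: real assume "e > 0"
    then obtain m where m: "1 / real (Suc m) < e"
      using nat_approx_posE by blast
    have "dist (x (enumerate B k)) l < e" if k: "k \<ge> Suc (N m)" for k
    proof -
      obtain m' where m': "enumerate B k \<in> A m'" "enumerate B k \<le> N (Suc m')"
        using enumerate_in_set[OF B_inf, of k] by (auto simp: B_def)
      \<comment> \<open>The k-th element of \<open>B\<close> is at least \<open>k\<close>, hence
        beyond \<open>N m\<close>, so it cannot come from a block before the m-th.\<close>
      have "N m < N (Suc m')"
        using k le_enumerate[OF B_inf, of k] m'(2) by linarith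
      then have "m \<le> m'"
        using N_mono by (simp add: strict_mono_less)
      then have "1 / real (Suc m') \<le> 1 / real (Suc m)"
        by (simp add: frac_le)
      moreover have "dist (x (enumerate B k)) l < 1 / real (Suc m')"
        using m'(1) by (simp add: A_def)
      ultimately show ?thesis
        using m by linarith
    qed
    then show "\<exists>K. \<forall>k\<ge>K. dist (x (enumerate B k)) l < e" by blast
  qed
  moreover have "B \<notin> submeasure_ideal \<phi>"
    using B_pos by (auto simp: submeasure_ideal_def)
  ultimately show "l \<in> ideal_limit_points (submeasure_ideal \<phi>) x"
    unfolding ideal_limit_points_def
    using strict_mono_enumerate[OF B_inf] range_enumerate[OF B_inf] B
    by (intro CollectI exI[of _ "enumerate B"]) auto
qed

end

section \<open>Thinning by dyadic digits\<close>

definition digit_set :: "real \<Rightarrow> nat set" where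
  "digit_set \<omega> = {i. i \<ge> 1 \<and> dyadic_digit \<omega> i \<noteq> 0}"

lemma subseq_along_eq: "subseq_along x \<omega> n = x (nth_elem (digit_set \<omega>) n)"
  by (simp add: subseq_along_def digit_set_def)

lemma digit_set_subset: "digit_set \<omega> \<subseteq> {1..}"
  by (auto simp: digit_set_def)

lemma infinite_digit_set:
  assumes "\<omega> \<in> {0<..1}"
  shows "infinite (digit_set \<omega>)"
proof -
  have d: "is_dyadic_expansion (dyadic_digit \<omega>) \<omega>"
    using assms by (rule is_dyadic_expansion_dyadic_digit)
  have "{i. dyadic_digit \<omega> i = 1} \<subseteq> digit_set \<omega>"
  proof
    fix i assume "i \<in> {i. dyadic_digit \<omega> i = 1}"
    then show "i \<in> digit_set \<omega>"
      using d by (cases i) (auto simp: digit_set_def is_dyadic_expansion_def)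
  qed
  moreover have "infinite {i. dyadic_digit \<omega> i = 1}"
    using d by (simp add: is_dyadic_expansion_def)
  ultimately show ?thesis
    using finite_subset by blast
qed

text \<open>The mean of the first n digits along \<open>a\<close> is the frequency of indices that
  hit the digit set. The shift \<open>k - 1\<close> reconciles \<open>a\<close>, indexed from 0,
  with density, which counts from 1.\<close>

lemma AE_digit_set_density_half:
  fixes a :: "nat \<Rightarrow> nat"
  assumes a: "strict_mono a" "\<And>k. a k \<ge> 1"
  shows "AE \<omega> in lborel. \<omega> \<in> {0<..1} \<longrightarrow>
           has_density {k. 1 \<le> k \<and> a (k - 1) \<in> digit_set \<omega>} (1 / 2)"
  using AE_dyadic_digit_mean_half[OF a]
proof eventually_elim
  case (elim \<omega>)
  show ?case
  proof
    assume \<omega>: "\<omega> \<in> {0<..1}"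
    have digit: "real (dyadic_digit \<omega> i) = of_bool (i \<in> digit_set \<omega>)" if "i \<ge> 1" for i
    proof -
      have "dyadic_digit \<omega> i \<in> {0, 1}"
        using is_dyadic_expansion_dyadic_digit[OF \<omega>] by (simp only: is_dyadic_expansion_def)
      then show ?thesis
        using that by (auto simp: digit_set_def)
    qed
    have "real (card ({k. 1 \<le> k \<and> a (k - 1) \<in> digit_set \<omega>} \<inter> {1..n}))
        = (\<Sum>k<n. real (dyadic_digit \<omega> (a k)))" for n
    proof -
      have "{k. 1 \<le> k \<and> a (k - 1) \<in> digit_set \<omega>} \<inter> {1..n}
          = Suc ` ({k. a k \<in> digit_set \<omega>} \<inter> {..<n})"
      proof -
        have "k \<in> Suc ` ({k. a k \<in> digit_set \<omega>} \<inter> {..<n})" if "1 \<le> k" "k \<le> n" "a (k - 1) \<in> digit_set \<omega>" for k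
          using that by (intro image_eqI[of _ _ "k - 1"]) auto
        then show ?thesis by auto
      qed
      then have "card ({k. 1 \<le> k \<and> a (k - 1) \<in> digit_set \<omega>} \<inter> {1..n})
          = card ({k. a k \<in> digit_set \<omega>} \<inter> {..<n})"
        by (simp add: card_image)
      moreover have "(\<Sum>k<n. real (dyadic_digit \<omega> (a k))) = (\<Sum>k<n. of_bool (a k \<in> digit_set \<omega>))"
        using a(2) by (simp add: digit)
      ultimately show ?thesis
        by (simp add: Int_commute)
    qed
    then show "has_density {k. 1 \<le> k \<and> a (k - 1) \<in> digit_set \<omega>} (1 / 2)"
      using elim \<omega> by (simp add: has_density_def)
  qed
qed

text \<open>A subsequence of the thinned sequence with index set \<open>range n\<close> is a
  subsequence of \<open>x\<close> with index set \<open>sub_index D (range n)\<close>, which weak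
  thinnability keeps outside \<open>I\<close>.\<close>

lemma ideal_limit_points_subseq_subset:
  assumes thin: "weakly_thinnable I"
    and D: "D \<subseteq> {1..}" "infinite D" "has_density D a" "a \<noteq> 0"
  shows "ideal_limit_points I (\<lambda>n. x (nth_elem D n)) \<subseteq> ideal_limit_points I x"
proof
  fix l assume "l \<in> ideal_limit_points I (\<lambda>n. x (nth_elem D n))"
  then obtain n where n: "strict_mono n" "range n \<subseteq> {1..}"
      "(\<lambda>k. x (nth_elem D (n k))) \<longlonglongrightarrow> l" "range n \<notin> I"
    by (auto simp: ideal_limit_points_def)
  have "sub_index D (range n) \<notin> I"
    using thin D n(2,4) unfolding weakly_thinnable_def by blast
  moreover have "range (\<lambda>k. nth_elem D (n k)) = sub_index D (range n)"
    by (auto simp: sub_index_def)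
  moreover have "strict_mono (\<lambda>k. nth_elem D (n k))"
  proof (rule strict_monoI)
    fix k m :: nat assume "k < m"
    then show "nth_elem D (n k) < nth_elem D (n m)"
      using n(1,2) by (intro nth_elem_less D) (auto simp: strict_mono_def subset_iff)
  qed
  moreover have "range (\<lambda>k. nth_elem D (n k)) \<subseteq> {1..}"
    using nth_elem_in[OF D(2)] D(1) by blast
  ultimately show "l \<in> ideal_limit_points I x"
    unfolding ideal_limit_points_def using n(3) by (auto intro!: exI[of _ "\<lambda>k. nth_elem D (n k)"])
qed

text \<open>The set agrees almost everywhere with (0,1], so completeness of Lebesgue measure yields
  its measurability as well as its measure.\<close>

lemma AE_imp_full_measure_unit_interval:
  assumes "AE \<omega> in lborel. \<omega> \<in> {0<..1::real} \<longrightarrow> P \<omega>"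
  shows "{\<omega> \<in> {0<..1}. P \<omega>} \<in> sets (lebesgue_on {0<..1})"
    and "emeasure (lebesgue_on {0<..1}) {\<omega> \<in> {0<..1}. P \<omega>} = 1"
proof -
  let ?S = "{\<omega> \<in> {0<..1}. P \<omega>}"
  have ae: "AE \<omega> in lebesgue. \<omega> \<in> {0<..1} \<longleftrightarrow> \<omega> \<in> ?S"
    using AE_completion[OF assms] by eventually_elim auto
  have sets: "?S \<in> sets lebesgue"
    by (rule completion.in_sets_AE[OF ae]) auto
  then show "?S \<in> sets (lebesgue_on {0<..1})"
    by (auto simp: sets_restrict_space image_iff intro!: bexI[of _ ?S])
  have "emeasure lebesgue ?S = emeasure lebesgue {0<..1::real}"
    using ae sets by (intro emeasure_eq_AE) auto
  then show "emeasure (lebesgue_on {0<..1}) ?S = 1"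
    by (subst emeasure_restrict_space) auto
qed

theorem theorem4p2:
  fixes \<phi> :: "nat set \<Rightarrow> ennreal"
    and x :: "nat \<Rightarrow> 'a::metric_space"
  assumes "lsc_submeasure \<phi>"
    and "strongly_thinnable (submeasure_ideal \<phi>)"
    and "separable_space (euclidean :: 'a topology)"
  shows "{\<omega> \<in> {0<..1}. ideal_limit_points (submeasure_ideal \<phi>) x
             = ideal_limit_points (submeasure_ideal \<phi>) (subseq_along x \<omega>)}
           \<in> sets (lebesgue_on {0<..1})
       \<and> emeasure (lebesgue_on {0<..1})
           {\<omega> \<in> {0<..1}. ideal_limit_points (submeasure_ideal \<phi>) x
             = ideal_limit_points (submeasure_ideal \<phi>) (subseq_along x \<omega>)} = 1"
proof -
  define I where "I = submeasure_ideal \<phi>"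
  \<comment> \<open>Strong thinnability supplies some submeasure with the same ideal, possibly other
    than \<open>\<phi>\<close>. All norms below are taken with respect to it.\<close>
  obtain \<psi> and c' :: real where \<psi>: "lsc_submeasure \<psi>" "I = submeasure_ideal \<psi>"
      "weakly_thinnable (submeasure_ideal \<psi>)"
    and ii: "\<forall>q::real. q > 0 \<longrightarrow> (\<forall>a::real. a > 0 \<longrightarrow> (\<exists>c::real. c > 0 \<and>
           (\<forall>A B. A \<subseteq> {1..} \<and> has_density A a \<and>
                  B \<subseteq> {1..} \<and> submeasure_norm \<psi> B \<ge> ennreal q
              \<longrightarrow> submeasure_norm \<psi> (sub_index B A) \<ge> ennreal (c * q))))"
    and c': "c' > 0"
    and iii: "\<forall>X Y. X \<subseteq> {1..} \<and> Y \<subseteq> {1..} \<and> infinite X \<and> infinite Y \<and> set_le X Y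
              \<longrightarrow> submeasure_norm \<psi> X \<ge> ennreal c' * submeasure_norm \<psi> Y"
    using assms(2) unfolding strongly_thinnable_def I_def[symmetric]
    by (elim conjE exE) (rule that)
  note iff = ideal_limit_points_iff[OF \<psi>(1), folded \<psi>(2)]
  obtain S :: "'a set" where S: "countable S" "closure S = UNIV"
    using assms(3) by (auto simp: separable_space_def)
  define V where "V y s m = {n. 1 \<le> n \<and> dist (y n) s < 1 / real (Suc m)}"
    for y :: "nat \<Rightarrow> 'a" and s m
  have V_sub: "V y s m \<subseteq> {1..}" for y s m
    by (auto simp: V_def)
  \<comment> \<open>Only infinite index sets have a full enumeration to thin. Countability of
    \<open>R\<close> lets a single null set serve all of them.\<close>
  define R where "R = {(s, m) \<in> S \<times> UNIV. infinite (V x s m)}"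
  have "countable R"
    unfolding R_def by (rule countable_subset[of _ "S \<times> UNIV"]) (use S(1) in auto)
  moreover have "AE \<omega> in lborel. \<omega> \<in> {0<..1} \<longrightarrow>
      has_density {k. 1 \<le> k \<and> nth_elem (V x s m) k \<in> digit_set \<omega>} (1 / 2)" if "(s, m) \<in> R" for s m
  proof -
    have inf: "infinite (V x s m)"
      using that by (simp add: R_def)
    have "1 \<le> enumerate (V x s m) k" for k
      using enumerate_in_set[OF inf] V_sub by fastforce
    from AE_digit_set_density_half[OF strict_mono_enumerate[OF inf] this] show ?thesis
      unfolding nth_elem_def .
  qed
  ultimately have "AE \<omega> in lborel. \<forall>r\<in>R. \<omega> \<in> {0<..1} \<longrightarrow>
      has_density {k. 1 \<le> k \<and> nth_elem (V x (fst r) (snd r)) k \<in> digit_set \<omega>} (1 / 2)"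
    by (subst AE_ball_countable) auto
  moreover have "AE \<omega> in lborel. \<omega> \<in> {0<..1} \<longrightarrow> has_density (digit_set \<omega>) (1 / 2)"
  proof -
    \<comment> \<open>\<open>Suc\<close> enumerates the positive integers from index 0.\<close>
    have "{k. 1 \<le> k \<and> Suc (k - 1) \<in> digit_set \<omega>} = digit_set \<omega>" for \<omega>
      by (auto simp: digit_set_def)
    then show ?thesis
      using AE_digit_set_density_half[of Suc] by (simp add: strict_mono_Suc_iff)
  qed
  ultimately have "AE \<omega> in lborel. \<omega> \<in> {0<..1} \<longrightarrow>
      ideal_limit_points I x = ideal_limit_points I (subseq_along x \<omega>)"
  proof eventually_elim
    case (elim \<omega>)
    show ?case
    proof (intro impI equalityI)
      assume \<omega>: "\<omega> \<in> {0<..1}"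
      define D where "D = digit_set \<omega>"
      have D: "D \<subseteq> {1..}" "infinite D" "has_density D (1 / 2)"
        using digit_set_subset infinite_digit_set[OF \<omega>] elim(2) \<omega> by (auto simp: D_def)
      have y: "subseq_along x \<omega> = (\<lambda>n. x (nth_elem D n))"
        by (simp add: fun_eq_iff subseq_along_eq D_def)
      show "ideal_limit_points I (subseq_along x \<omega>) \<subseteq> ideal_limit_points I x"
        unfolding y \<psi>(2)
        by (rule ideal_limit_points_subseq_subset[OF \<psi>(3) D]) simp
      show "ideal_limit_points I x \<subseteq> ideal_limit_points I (subseq_along x \<omega>)"
      proof
        fix l assume "l \<in> ideal_limit_points I x"
        then obtain q :: real where q: "q > 0"
          "\<And>e. e > 0 \<Longrightarrow> ennreal q \<le> submeasure_norm \<psi> {n. 1 \<le> n \<and> dist (x n) l < e}"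
          unfolding iff by blast
        \<comment> \<open>\<open>c\<close> depends on \<open>q\<close> and the density 1/2 alone,
          and is fixed before \<open>e\<close>; the resulting bound is therefore the same for all
          neighbourhoods of \<open>l\<close>.\<close>
        obtain c :: real where c: "c > 0"
          "\<And>A B. A \<subseteq> {1..} \<Longrightarrow> has_density A (1 / 2) \<Longrightarrow> B \<subseteq> {1..} \<Longrightarrow> submeasure_norm \<psi> B \<ge> ennreal q
              \<Longrightarrow> submeasure_norm \<psi> (sub_index B A) \<ge> ennreal (c * q)"
          using ii[rule_format, OF q(1), of "1 / 2"] by auto
        have pos: "0 < c * q"
          using c(1) q(1) by simp
        have "ennreal (c' * (c * q))
            \<le> submeasure_norm \<psi> {n. 1 \<le> n \<and> dist (subseq_along x \<omega> n) l < e}" if e: "e > 0" for e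
        proof -
          \<comment> \<open>The ball about \<open>s\<close> of radius 1/(m+1) will contain
            \<open>l\<close>; as the radius is below \<open>e / 2\<close>, the ball lies within
            distance \<open>e\<close> of \<open>l\<close>.\<close>
          obtain m where m: "1 / real (Suc m) < e / 2"
            using nat_approx_posE[of "e / 2"] e by auto
          obtain s where s: "s \<in> S" "dist s l < 1 / real (Suc m)"
            using S(2) closure_approachable[of l S] by (auto dest: spec[of _ "1 / real (Suc m)"])
          define A where "A = V x s m"
          have "{n. 1 \<le> n \<and> dist (x n) l < 1 / real (Suc m) - dist s l} \<subseteq> A"
          proof
            fix n assume "n \<in> {n. 1 \<le> n \<and> dist (x n) l < 1 / real (Suc m) - dist s l}"
            then show "n \<in> A"
              using dist_triangle[of "x n" s l] by (auto simp: A_def V_def dist_commute)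
          qed
          \<comment> \<open>The ball about \<open>s\<close> contains a ball of positive radius about
            \<open>l\<close>, so its index set inherits the bound \<open>q\<close>. With
            \<open>m = 0\<close> the discarded segment \<open>{1..0}\<close> is empty.\<close>
          then have "submeasure_norm \<psi> {n. 1 \<le> n \<and> dist (x n) l < 1 / real (Suc m) - dist s l}
              \<le> submeasure_norm \<psi> A"
            by (intro submeasure_norm_mono_almost[OF \<psi>(1), of _ 0]) (auto simp: A_def V_def)
          with q(2)[of "1 / real (Suc m) - dist s l"] s(2)
          have A_norm: "ennreal q \<le> submeasure_norm \<psi> A"
            by simp
          have A_sub: "A \<subseteq> {1..}"
            unfolding A_def by (rule V_sub)
          have A_inf: "infinite A"
            using A_norm q(1)
            by (intro infinite_if_submeasure_norm_pos[OF \<psi>(1) A_sub]) (auto intro: less_le_trans[rotated])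
          \<comment> \<open>The times at which the thinned sequence visits the ball about
            \<open>s\<close>.\<close>
          define B where "B = {k. 1 \<le> k \<and> nth_elem D k \<in> A}"
          have B_sub: "B \<subseteq> {1..}"
            by (auto simp: B_def)
          have DB: "sub_index D B = A \<inter> D"
            unfolding B_def using sub_index_preimage[OF D(2)] by (simp add: Int_commute)
          have "(s, m) \<in> R"
            using s(1) A_inf by (simp add: R_def A_def)
          then have "has_density {k. 1 \<le> k \<and> nth_elem A k \<in> D} (1 / 2)"
            using elim(1) \<omega> by (force simp: A_def D_def)
          \<comment> \<open>The set of density 1/2 consists of the indices at which the enumeration
            of \<open>A\<close> meets \<open>D\<close>; thinning \<open>A\<close> along it gives A
            \<inter> D.\<close>
          from c(2)[OF _ this A_sub A_norm]
          have AD_norm: "ennreal (c * q) \<le> submeasure_norm \<psi> (A \<inter> D)"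
            unfolding sub_index_preimage[OF A_inf] by auto
          then have AD_inf: "infinite (A \<inter> D)"
            using pos A_sub
            by (intro infinite_if_submeasure_norm_pos[OF \<psi>(1)]) (auto intro: less_le_trans[rotated])
          then have B_inf: "infinite B"
            unfolding DB[symmetric] sub_index_def by blast
          have "ennreal (c' * (c * q)) = ennreal c' * ennreal (c * q)"
            using c' pos by (simp add: ennreal_mult)
          also have "\<dots> \<le> ennreal c' * submeasure_norm \<psi> (A \<inter> D)"
            using AD_norm by (rule mult_left_mono) simp
          \<comment> \<open>Since \<open>B\<close> precedes \<open>sub_index D B\<close>, which is A
            \<inter> D, the comparison constant \<open>c'\<close> carries the bound from positions
            in \<open>x\<close> to positions in the thinned sequence.\<close>
          also have "\<dots> \<le> submeasure_norm \<psi> B"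
            using set_le_sub_index[OF D(2,1) B_inf B_sub] B_sub A_sub B_inf AD_inf
            by (intro iii[rule_format]) (auto simp: DB)
          also have "\<dots> \<le> submeasure_norm \<psi> {n. 1 \<le> n \<and> dist (subseq_along x \<omega> n) l < e}"
          proof (rule submeasure_norm_mono_almost[OF \<psi>(1), of _ 0])
            show "B - {1..0} \<subseteq> {n. 1 \<le> n \<and> dist (subseq_along x \<omega> n) l < e}"
            proof
              fix k assume "k \<in> B - {1..0}"
              then have k: "1 \<le> k" "dist (x (nth_elem D k)) s < 1 / real (Suc m)"
                by (auto simp: B_def A_def V_def)
              then have "dist (x (nth_elem D k)) l < e"
                using dist_triangle[of "x (nth_elem D k)" l s] s(2) m by linarith
              then show "k \<in> {n. 1 \<le> n \<and> dist (subseq_along x \<omega> n) l < e}"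
                using k(1) by (simp add: y)
            qed
          qed (use B_sub in auto)
          finally show ?thesis .
        qed
        then show "l \<in> ideal_limit_points I (subseq_along x \<omega>)"
          unfolding iff using c' pos by (intro exI[of _ "c' * (c * q)"]) auto
      qed
    qed
  qed
  then show ?thesis
    unfolding I_def by (intro conjI AE_imp_full_measure_unit_interval)
qed

end
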